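(* Let $\mathcal{G}=(\mathcal{V},\mathcal{E})$ be a connected undirected graph on $n\ge 2$ nodes and let $k>0$. The attacker-defender game with payoff $J_2(\mathfrak{F},\mathfrak{D})$ with a single attacked node and a single defense node ($|\mathfrak{F}|=|\mathfrak{D}|=1$) does not admit a Nash equilibrium.
   Context: $\mathcal{G}$ is simple and unweighted, with Laplacian matrix $L=D-A$ ($A$ the adjacency matrix, $D$ the diagonal matrix of degrees). For a nonempty set $\mathfrak{D}\subseteq\mathcal{V}$ of defense nodes, $D_y=\mathrm{diag}(y)$ with $y_i=1$ if $i\in\mathfrak{D}$ and $y_i=0$ otherwise, and $\bar L=L+kD_y$ (invertible). For a set $\mathfrak{F}\subseteq\mathcal{V}$ of $f$ attacked nodes the payoff is $$J_2(\mathfrak{F},\mathfrak{D})=\frac12 f+\frac12\sum_{i\in\mathfrak{F}}\bar L^{-1}_{ii},$$ where $\bar L^{-1}_{ii}$ is the $i$-th diagonal element of $\bar L^{-1}$. The game is zero-sum: the attacker chooses $\mathfrak{F}$ to maximize the payoff and the defender simultaneously chooses $\mathfrak{D}$ to minimize it. With one attacked node $j$ and one defense node $i$, it is the matrix game $\mathcal{M}_{ij}=J_2(\{j\},\{i\})$. A Nash equilibrium is a (pure-strategy) saddle point, i.e. a pair $(i^*,j^* )$ with $\mathcal{M}_{i^*j}\le\mathcal{M}_{i^*j^*}\le\mathcal{M}_{ij^*}$ for all $i,j\in\mathcal{V}$. *)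

theory Defs
  imports "HOL-Analysis.Analysis" "Graph_Theory.Graph_Theory"
begin

text \<open>
  A simple undirected graph is a \<open>pair_graph\<close>, an edge being represented by both of its
  orientations; the degree of a node is therefore its out-degree. Since node-indexed matrices have
  type \<open>real ^ 'n ^ 'n\<close>, the definitions are meant for graphs with \<open>pverts G = UNIV\<close>.
\<close>

definition diag_matrix :: "('n \<Rightarrow> real) \<Rightarrow> real ^ 'n ^ 'n"
  where "diag_matrix d = (\<chi> i j. if i = j then d i else 0)"

definition adjacency_matrix :: "'n pair_pre_digraph \<Rightarrow> real ^ 'n ^ 'n"
  where "adjacency_matrix G = (\<chi> i j. if (i, j) \<in> parcs G then 1 else 0)"

definition degree_matrix :: "'n pair_pre_digraph \<Rightarrow> real ^ 'n ^ 'n"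
  where "degree_matrix G = diag_matrix (\<lambda>i. real (out_degree (with_proj G) i))"

definition laplacian :: "'n pair_pre_digraph \<Rightarrow> real ^ 'n ^ 'n"
  where "laplacian G = degree_matrix G - adjacency_matrix G"

definition defended_laplacian :: "'n pair_pre_digraph \<Rightarrow> real \<Rightarrow> 'n set \<Rightarrow> real ^ 'n ^ 'n"
  where "defended_laplacian G k \<DD> =
    laplacian G + k *\<^sub>R diag_matrix (\<lambda>i. if i \<in> \<DD> then 1 else 0)"

definition J2 :: "'n::finite pair_pre_digraph \<Rightarrow> real \<Rightarrow> 'n set \<Rightarrow> 'n set \<Rightarrow> real"
  where "J2 G k \<FF> \<DD> =
    1/2 * real (card \<FF>) + 1/2 * (\<Sum>i\<in>\<FF>. matrix_inv (defended_laplacian G k \<DD>) $ i $ i)"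

text \<open>The row \<open>i\<close> is the defense node, the column \<open>j\<close> the attacked node.\<close>

definition game_matrix :: "'n::finite pair_pre_digraph \<Rightarrow> real \<Rightarrow> 'n \<Rightarrow> 'n \<Rightarrow> real"
  where "game_matrix G k i j = J2 G k {j} {i}"

text \<open>Pure-strategy equilibrium of a zero-sum matrix game: rows minimize, columns maximize.\<close>

definition nash_equilibrium :: "('a \<Rightarrow> 'b \<Rightarrow> real) \<Rightarrow> 'a \<Rightarrow> 'b \<Rightarrow> bool"
  where "nash_equilibrium M i' j' \<longleftrightarrow> (\<forall>i j. M i' j \<le> M i' j' \<and> M i' j' \<le> M i j')"

end

theory Submission
  imports Defs
begin

text \<open>
  Read the graph as an electrical network of unit resistors in which the defense node \<open>i\<close> is joined
  to earth by a resistor of conductance \<open>k\<close>. Column \<open>j\<close> of the inverse of \<open>L + k D\<close> is the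
  potential \<open>x\<close> produced by a unit current that enters at \<open>j\<close>. All of this current leaves through
  the earth resistor, which forces \<open>x\<^sub>i = 1/k\<close>; the power supplied, \<open>x\<^sub>j\<close>, is the power dissipated,
  so that \<open>x\<^sub>j = 1/k + E(x)\<close> where \<open>E\<close> is the power dissipated in the edges (the effective
  resistance between \<open>i\<close> and \<open>j\<close>). For \<open>j = i\<close> the value is \<open>1/k\<close>; for \<open>j \<noteq> i\<close> the potential is not
  constant, and \<open>E(x) > 0\<close> because the graph is connected.

  Thus the payoff is strictly smallest exactly on the diagonal of the game matrix. At a saddle
  point the attacker could always avoid the defense node (there are at least two nodes), so
  the value exceeds the diagonal payoff; but the defender could always move to the attacked
  node, so the value is at most the diagonal payoff.
\<close>

text \<open>The factor \<open>1/2\<close> makes up for summing every edge in both orientations.\<close>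

definition edge_energy :: "'n::finite pair_pre_digraph \<Rightarrow> real ^ 'n \<Rightarrow> real"
  where "edge_energy G x =
    1/2 * (\<Sum>u\<in>UNIV. \<Sum>v\<in>UNIV. adjacency_matrix G $ u $ v * (x $ u - x $ v)\<^sup>2)"

lemma adjacency_matrix_symmetric:
  assumes "pair_graph G"
  shows "adjacency_matrix G $ u $ v = adjacency_matrix G $ v $ u"
proof -
  interpret pair_graph G by fact
  show ?thesis
    using graph_symmetric by (auto simp: adjacency_matrix_def)
qed

lemma out_degree_eq_row_sum:
  fixes G :: "'n::finite pair_pre_digraph"
  shows "real (out_degree (with_proj G) u) = (\<Sum>v\<in>UNIV. adjacency_matrix G $ u $ v)"
proof -
  have "out_arcs (with_proj G) u = Pair u ` {v. (u, v) \<in> parcs G}"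
    by (auto simp: out_arcs_def)
  then have "out_degree (with_proj G) u = card {v. (u, v) \<in> parcs G}"
    by (simp add: out_degree_def card_image inj_on_def)
  then show ?thesis
    by (simp add: adjacency_matrix_def sum.If_cases)
qed

lemma laplacian_mult_vec:
  fixes G :: "'n::finite pair_pre_digraph"
  shows "(laplacian G *v x) $ u = (\<Sum>v\<in>UNIV. adjacency_matrix G $ u $ v * (x $ u - x $ v))"
proof -
  have "(laplacian G *v x) $ u =
      (\<Sum>v\<in>UNIV. (if u = v then real (out_degree (with_proj G) u) * x $ v else 0)
        - adjacency_matrix G $ u $ v * x $ v)"
    unfolding matrix_vector_mult_def laplacian_def degree_matrix_def diag_matrix_def
    by (auto intro!: sum.cong simp: algebra_simps)
  also have "\<dots> = (\<Sum>v\<in>UNIV. adjacency_matrix G $ u $ v) * x $ u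
        - (\<Sum>v\<in>UNIV. adjacency_matrix G $ u $ v * x $ v)"
    by (simp add: sum_subtractf out_degree_eq_row_sum)
  finally show ?thesis
    by (simp add: sum_distrib_right right_diff_distrib sum_subtractf)
qed

lemma defended_laplacian_mult_vec:
  fixes G :: "'n::finite pair_pre_digraph"
  shows "(defended_laplacian G k {i} *v x) $ u =
    (laplacian G *v x) $ u + (if u = i then k * x $ i else 0)"
proof -
  have "(diag_matrix (\<lambda>v. if v \<in> {i} then 1 else 0) *v x) $ u =
      (if u = i then x $ i else 0)"
    by (simp add: matrix_vector_mult_def diag_matrix_def if_distribR if_distrib[of "\<lambda>c. c * _"]
        cong: if_cong)
  then show ?thesis
    by (simp add: defended_laplacian_def matrix_vector_mult_add_rdistrib
        scaleR_matrix_vector_assoc[symmetric])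
qed

text \<open>
  Conservation of current: what two adjacent nodes send each other cancels, by symmetry, so the
  total of the injected currents flows to earth.
\<close>

lemma sum_laplacian_mult_vec:
  fixes G :: "'n::finite pair_pre_digraph"
  assumes "pair_graph G"
  shows "(\<Sum>u\<in>UNIV. (laplacian G *v x) $ u) = 0"
proof -
  let ?a = "\<lambda>u v. adjacency_matrix G $ u $ v"
  have "(\<Sum>u\<in>UNIV. \<Sum>v\<in>UNIV. ?a u v * x $ u) = (\<Sum>v\<in>UNIV. \<Sum>u\<in>UNIV. ?a u v * x $ u)"
    by (rule sum.swap)
  also have "\<dots> = (\<Sum>u\<in>UNIV. \<Sum>v\<in>UNIV. ?a u v * x $ v)"
    by (subst adjacency_matrix_symmetric[OF assms]) (rule refl)
  finally show ?thesis
    by (simp add: laplacian_mult_vec right_diff_distrib sum_subtractf)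
qed

lemma sum_defended_laplacian_mult_vec:
  fixes G :: "'n::finite pair_pre_digraph"
  assumes "pair_graph G"
  shows "(\<Sum>u\<in>UNIV. (defended_laplacian G k {i} *v x) $ u) = k * x $ i"
  by (simp add: defended_laplacian_mult_vec sum.distrib sum_laplacian_mult_vec[OF assms])

lemma inner_laplacian_mult_vec:
  fixes G :: "'n::finite pair_pre_digraph"
  assumes "pair_graph G"
  shows "x \<bullet> (laplacian G *v x) = edge_energy G x"
proof -
  let ?a = "\<lambda>u v. adjacency_matrix G $ u $ v"
  let ?S = "\<Sum>u\<in>UNIV. \<Sum>v\<in>UNIV. ?a u v * (x $ u * (x $ u - x $ v))"
  have S: "x \<bullet> (laplacian G *v x) = ?S"
    by (simp add: inner_vec_def laplacian_mult_vec sum_distrib_left mult.left_commute)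
  have "?S = (\<Sum>v\<in>UNIV. \<Sum>u\<in>UNIV. ?a u v * (x $ u * (x $ u - x $ v)))"
    by (rule sum.swap)
  also have "\<dots> = (\<Sum>u\<in>UNIV. \<Sum>v\<in>UNIV. ?a u v * (x $ v * (x $ v - x $ u)))"
    by (subst adjacency_matrix_symmetric[OF assms]) (rule refl)
  \<comment> \<open>Adding the two forms of the sum turns the linear factor \<open>x\<^sub>u\<close> into the difference.\<close>
  finally have "?S + ?S = (\<Sum>u\<in>UNIV. \<Sum>v\<in>UNIV.
      ?a u v * (x $ u * (x $ u - x $ v)) + ?a u v * (x $ v * (x $ v - x $ u)))"
    by (simp add: sum.distrib)
  also have "\<dots> = (\<Sum>u\<in>UNIV. \<Sum>v\<in>UNIV. ?a u v * (x $ u - x $ v)\<^sup>2)"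
    by (simp add: power2_eq_square algebra_simps)
  finally show ?thesis
    by (simp add: S edge_energy_def)
qed

lemma inner_defended_laplacian_mult_vec:
  fixes G :: "'n::finite pair_pre_digraph"
  assumes "pair_graph G"
  shows "x \<bullet> (defended_laplacian G k {i} *v x) = edge_energy G x + k * (x $ i)\<^sup>2"
proof -
  have "x \<bullet> (defended_laplacian G k {i} *v x) =
      (\<Sum>u\<in>UNIV. x $ u * (laplacian G *v x) $ u + (if u = i then k * (x $ i)\<^sup>2 else 0))"
    unfolding inner_vec_def
    by (auto intro!: sum.cong simp: defended_laplacian_mult_vec algebra_simps power2_eq_square)
  then show ?thesis
    by (simp add: sum.distrib inner_laplacian_mult_vec[OF assms, symmetric] inner_vec_def)
qed

lemma edge_energy_nonneg: "edge_energy G x \<ge> 0"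
  by (simp add: edge_energy_def adjacency_matrix_def sum_nonneg)

text \<open>
  Vanishing energy means equal potentials across every edge, and connectivity carries this
  equality along paths.
\<close>

lemma edge_energy_eq_0_imp_constant:
  fixes G :: "'n::finite pair_pre_digraph"
  assumes "pair_graph G" "pverts G = UNIV" "Digraph_Component.connected (with_proj G)"
    and "edge_energy G x = 0"
  shows "x $ u = x $ v"
proof -
  interpret pair_graph G by fact
  have nonneg: "0 \<le> adjacency_matrix G $ p $ q * (x $ p - x $ q)\<^sup>2" for p q
    by (simp add: adjacency_matrix_def)
  have "\<forall>p\<in>UNIV. (\<Sum>q\<in>UNIV. adjacency_matrix G $ p $ q * (x $ p - x $ q)\<^sup>2) = 0"
    using assms(4) unfolding edge_energy_def
    by (subst sum_nonneg_eq_0_iff[symmetric]) (auto intro: sum_nonneg nonneg)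
  then have "adjacency_matrix G $ p $ q * (x $ p - x $ q)\<^sup>2 = 0" for p q
    using sum_nonneg_eq_0_iff[of UNIV "\<lambda>q. adjacency_matrix G $ p $ q * (x $ p - x $ q)\<^sup>2"]
      nonneg by auto
  then have edge: "x $ p = x $ q" if "(p, q) \<in> parcs G" for p q
    using that by (force simp: adjacency_matrix_def split: if_splits)
  have "strongly_connected (with_proj G)"
    using symmetric_connected_imp_strongly_connected sym_arcs assms(3) by blast
  then have "u \<rightarrow>\<^sup>*\<^bsub>with_proj G\<^esub> v"
    using assms(2) by auto
  then show ?thesis
    by (induction rule: reachable_induct) (auto dest: edge)
qed

lemma invertible_defended_laplacian:
  fixes G :: "'n::finite pair_pre_digraph"
  assumes "pair_graph G" "pverts G = UNIV" "Digraph_Component.connected (with_proj G)"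
    and "k > 0"
  shows "invertible (defended_laplacian G k {i})"
proof -
  have "x = 0" if "defended_laplacian G k {i} *v x = 0" for x
  proof -
    have "edge_energy G x + k * (x $ i)\<^sup>2 = 0"
      using inner_defended_laplacian_mult_vec[OF assms(1), of x k i] that by simp
    moreover have "k * (x $ i)\<^sup>2 \<ge> 0"
      using assms(4) by simp
    ultimately have "edge_energy G x = 0" "k * (x $ i)\<^sup>2 = 0"
      using edge_energy_nonneg[of G x] by linarith+
    then have "x $ u = 0" for u
      using edge_energy_eq_0_imp_constant[OF assms(1-3), of x u i] assms(4) by simp
    then show ?thesis
      by (simp add: vec_eq_iff)
  qed
  then show ?thesis
    by (simp add: invertible_left_inverse matrix_left_invertible_ker)
qed

text \<open>The power balance of the network; the edge energy is the effective resistance.\<close>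

lemma inverse_diagonal_eq_energy:
  fixes G :: "'n::finite pair_pre_digraph"
  assumes "pair_graph G" "pverts G = UNIV" "Digraph_Component.connected (with_proj G)"
    and "k > 0"
  obtains x where "defended_laplacian G k {i} *v x = axis j 1" "x $ i = 1 / k"
    "matrix_inv (defended_laplacian G k {i}) $ j $ j = x $ j"
    "x $ j = 1 / k + edge_energy G x"
proof -
  let ?B = "defended_laplacian G k {i}"
  define x where "x = matrix_inv ?B *v axis j 1"
  have "?B ** matrix_inv ?B = mat 1"
    using invertible_defended_laplacian[OF assms]
    unfolding invertible_def matrix_inv_def by (metis (mono_tags, lifting) someI_ex)
  then have Bx: "?B *v x = axis j 1"
    by (simp add: x_def matrix_vector_mul_assoc)
  have inv_jj: "matrix_inv ?B $ j $ j = x $ j"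
    by (simp add: x_def matrix_vector_mul_component inner_axis)
  have "k * x $ i = 1"
    using sum_defended_laplacian_mult_vec[OF assms(1), of k i x] by (simp add: Bx axis_def)
  then have xi: "x $ i = 1 / k"
    using assms(4) by (simp add: field_simps)
  have "x $ j = edge_energy G x + k * (x $ i)\<^sup>2"
    using inner_defended_laplacian_mult_vec[OF assms(1), of x k i] by (simp add: Bx inner_axis)
  then have "x $ j = 1 / k + edge_energy G x"
    using assms(4) by (simp add: xi power2_eq_square)
  with that Bx xi inv_jj show ?thesis by blast
qed

lemma inverse_diagonal_at_defended:
  fixes G :: "'n::finite pair_pre_digraph"
  assumes "pair_graph G" "pverts G = UNIV" "Digraph_Component.connected (with_proj G)"
    and "k > 0"
  shows "matrix_inv (defended_laplacian G k {i}) $ i $ i = 1 / k"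
  using inverse_diagonal_eq_energy[OF assms, of i i] by metis

lemma inverse_diagonal_off_defended:
  fixes G :: "'n::finite pair_pre_digraph"
  assumes "pair_graph G" "pverts G = UNIV" "Digraph_Component.connected (with_proj G)"
    and "k > 0" and "j \<noteq> i"
  shows "matrix_inv (defended_laplacian G k {i}) $ j $ j > 1 / k"
proof -
  obtain x where x: "defended_laplacian G k {i} *v x = axis j 1"
      "matrix_inv (defended_laplacian G k {i}) $ j $ j = x $ j"
      "x $ j = 1 / k + edge_energy G x"
    using inverse_diagonal_eq_energy[OF assms(1-4)] by metis
  have "edge_energy G x \<noteq> 0"
  proof
    assume "edge_energy G x = 0"
    then have "x $ u = x $ v" for u v
      by (rule edge_energy_eq_0_imp_constant[OF assms(1-3)])
    then have "(laplacian G *v x) $ j = 0"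
      unfolding laplacian_mult_vec by (metis (mono_tags) diff_self mult_zero_right sum.neutral)
    \<comment> \<open>A constant potential drives no current away from \<open>j\<close>, where a unit current enters.\<close>
    then have "(defended_laplacian G k {i} *v x) $ j = 0"
      using assms(5) by (simp add: defended_laplacian_mult_vec)
    then show False
      by (simp add: x(1))
  qed
  with edge_energy_nonneg[of G x] x show ?thesis
    by simp
qed

theorem proposition3:
  fixes G :: "'n::finite pair_pre_digraph" and k :: real
  assumes "pair_graph G"
    and "pverts G = UNIV"
    and "Digraph_Component.connected (with_proj G)"
    and "CARD('n) \<ge> 2"
    and "k > 0"
  shows "\<not> (\<exists>i j. nash_equilibrium (game_matrix G k) i j)"
proof
  assume "\<exists>i j. nash_equilibrium (game_matrix G k) i j"
  then obtain i j where
    attack: "\<And>q. game_matrix G k i q \<le> game_matrix G k i j" and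
    defend: "\<And>p. game_matrix G k i j \<le> game_matrix G k p j"
    unfolding nash_equilibrium_def by blast
  have payoff: "game_matrix G k p q =
      1/2 + 1/2 * matrix_inv (defended_laplacian G k {p}) $ q $ q" for p q
    by (simp add: game_matrix_def J2_def)
  have "\<not> UNIV \<subseteq> {i}"
    using card_mono[of "{i}" UNIV] assms(4) by auto
  then obtain q where "q \<noteq> i"
    by auto
  then have "1 / k < matrix_inv (defended_laplacian G k {i}) $ q $ q"
    by (rule inverse_diagonal_off_defended[OF assms(1-3,5)])
  also have "\<dots> \<le> matrix_inv (defended_laplacian G k {i}) $ j $ j"
    using attack[of q] by (simp add: payoff)
  also have "\<dots> \<le> matrix_inv (defended_laplacian G k {j}) $ j $ j"
    using defend[of j] by (simp add: payoff)
  also have "\<dots> = 1 / k"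
    by (rule inverse_diagonal_at_defended[OF assms(1-3,5)])
  finally show False
    by simp
qed

end
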